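(* Let $n,i,j$ be integers with $0<i<j\le n/2$ such that either $i=1$ or neither $i$ nor $j$ is a unit in $\mathbb{Z}_n$. If $C_n(i,j)$ is connected (equivalently $\gcd(n,i,j)=1$), twin-free, and $(n,i,j)\neq(10,1,3)$, then $$\operatorname{Det}(C_n(i,j))=2,\qquad \operatorname{Dist}(C_n(i,j))=2,\qquad \rho(C_n(i,j))=3.$$
   Context: $C_n(i,j)$ is the simple undirected graph with vertex set $\mathbb{Z}_n$ in which $a,b$ are adjacent iff $a-b\equiv\pm i$ or $a-b\equiv\pm j\pmod n$. Distinct vertices $v,w$ are twins if $N(v)=N(w)$ or $N[v]=N[w]$ (open, resp. closed neighborhoods); a graph is twin-free if no two distinct vertices are twins. A determining set of a graph $G$ is a vertex subset $W$ such that only the identity automorphism fixes every vertex of $W$; $\operatorname{Det}(G)$ is the minimum size of a determining set. A $d$-distinguishing coloring is an assignment of $d$ colors to the vertices such that only the identity automorphism preserves every color class setwise; $\operatorname{Dist}(G)$ is the minimum such $d$. If $\operatorname{Dist}(G)=2$, the cost $\rho(G)$ is the minimum size of a color class over all 2-distinguishing colorings of $G$. *)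

theory Defs
  imports
    "Graph_Theory.Graph_Theory"
    "HOL-Number_Theory.Residues"
    "HOL-Combinatorics.Permutations"
begin

text \<open>A simple undirected graph is a \<^locale>\<open>pair_graph\<close>: a finite, loop-free digraph whose arcs are
  pairs of vertices, each edge being represented by both of its orientations.\<close>

definition circulant :: "int \<Rightarrow> int \<Rightarrow> int \<Rightarrow> int pair_pre_digraph" where
  "circulant n i j =
     \<lparr> pverts = carrier (residue_ring n),
       parcs = {(a, b). a \<in> carrier (residue_ring n) \<and> b \<in> carrier (residue_ring n) \<and>
         ([a - b = i] (mod n) \<or> [a - b = - i] (mod n) \<or>
          [a - b = j] (mod n) \<or> [a - b = - j] (mod n))} \<rparr>"

lemma carrier_residue_ring: "carrier (residue_ring n) = {0..n - 1}"
  by (simp add: residue_ring_def)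

lemma pair_graph_circulant:
  assumes "0 < i" "i < j" "2 * j \<le> n"
  shows "pair_graph (circulant n i j)"
proof
  let ?G = "circulant n i j"
  let ?V = "{0..n - 1}"
  have sub: "parcs ?G \<subseteq> ?V \<times> ?V"
    by (auto simp: circulant_def carrier_residue_ring)
  show "fst e \<in> pverts ?G" "snd e \<in> pverts ?G" if "e \<in> parcs ?G" for e
    using that by (auto simp: circulant_def)
  show "finite (pverts ?G)"
    by (simp add: circulant_def carrier_residue_ring)
  show "finite (parcs ?G)"
    by (rule finite_subset[OF sub]) simp
  show "fst e \<noteq> snd e" if "e \<in> parcs ?G" for e
  proof
    assume "fst e = snd e"
    with that have "n dvd i \<or> n dvd j"
      by (auto simp: circulant_def cong_iff_dvd_diff)
    then show False
      using assms zdvd_imp_le[of n i] zdvd_imp_le[of n j] by auto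
  qed
  show "symmetric (with_proj ?G)"
  proof -
    have neg: "[b - a = - k] (mod n) \<longleftrightarrow> [a - b = k] (mod n)" for a b k :: int
      using cong_minus_minus_iff[of "a - b" k n] by simp
    have "sym (parcs ?G)"
      using neg[where k = i] neg[where k = "- i"] neg[where k = j] neg[where k = "- j"]
      by (auto simp: sym_def circulant_def)
    then show ?thesis
      by (simp add: symmetric_def)
  qed
qed

definition open_neighborhood :: "'a pair_pre_digraph \<Rightarrow> 'a \<Rightarrow> 'a set" where
  "open_neighborhood G v = {u \<in> pverts G. (v, u) \<in> parcs G}"

definition closed_neighborhood :: "'a pair_pre_digraph \<Rightarrow> 'a \<Rightarrow> 'a set" where
  "closed_neighborhood G v = insert v (open_neighborhood G v)"

definition twins :: "'a pair_pre_digraph \<Rightarrow> 'a \<Rightarrow> 'a \<Rightarrow> bool" where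
  "twins G v w \<longleftrightarrow> v \<in> pverts G \<and> w \<in> pverts G \<and> v \<noteq> w \<and>
     (open_neighborhood G v = open_neighborhood G w \<or>
      closed_neighborhood G v = closed_neighborhood G w)"

definition twin_free :: "'a pair_pre_digraph \<Rightarrow> bool" where
  "twin_free G \<longleftrightarrow> \<not> (\<exists>v w. twins G v w)"

text \<open>A permutation of the vertex set is extended by the identity outside of it, so that the
  identity automorphism is \<^const>\<open>id\<close>.\<close>

definition automorphisms :: "'a pair_pre_digraph \<Rightarrow> ('a \<Rightarrow> 'a) set" where
  "automorphisms G = {f. f permutes pverts G \<and>
     (\<forall>u\<in>pverts G. \<forall>v\<in>pverts G. (f u, f v) \<in> parcs G \<longleftrightarrow> (u, v) \<in> parcs G)}"

definition determining_set :: "'a pair_pre_digraph \<Rightarrow> 'a set \<Rightarrow> bool" where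
  "determining_set G W \<longleftrightarrow> W \<subseteq> pverts G \<and>
     (\<forall>f\<in>automorphisms G. (\<forall>w\<in>W. f w = w) \<longrightarrow> f = id)"

text \<open>The minima below range over nonempty sets of numbers for every finite graph
  (for \<open>cost\<close>: provided that a 2-distinguishing coloring exists).\<close>

definition Det :: "'a pair_pre_digraph \<Rightarrow> nat" where
  "Det G = (LEAST k. \<exists>W. determining_set G W \<and> card W = k)"

definition color_class :: "'a pair_pre_digraph \<Rightarrow> ('a \<Rightarrow> nat) \<Rightarrow> nat \<Rightarrow> 'a set" where
  "color_class G c q = {v \<in> pverts G. c v = q}"

definition distinguishing_coloring :: "'a pair_pre_digraph \<Rightarrow> nat \<Rightarrow> ('a \<Rightarrow> nat) \<Rightarrow> bool" where
  "distinguishing_coloring G d c \<longleftrightarrow> c ` pverts G \<subseteq> {..<d} \<and>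
     (\<forall>f\<in>automorphisms G.
        (\<forall>q<d. f ` color_class G c q = color_class G c q) \<longrightarrow> f = id)"

definition Dist :: "'a pair_pre_digraph \<Rightarrow> nat" where
  "Dist G = (LEAST d. \<exists>c. distinguishing_coloring G d c)"

text \<open>Only meaningful if \<open>Dist G = 2\<close>; both color classes are then nonempty.\<close>

definition cost :: "'a pair_pre_digraph \<Rightarrow> nat" where
  "cost G = (LEAST k. \<exists>c q. distinguishing_coloring G 2 c \<and> q < 2 \<and> card (color_class G c q) = k)"

end

theory Submission
  imports Defs
begin

text \<open>The lower bounds hold because of the reflections \<open>x \<mapsto> s - x\<close>. The one with \<open>s = 2 * a\<close>
  fixes \<open>a\<close>, so a determining set has at least two elements. The one with \<open>s = a + b\<close>
  preserves \<open>{a, b}\<close>, so a class of a distinguishing colouring with two colours has at least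
  three. One colour does not distinguish, since there are automorphisms other than the
  identity.

  The upper bounds hold because every automorphism is an affine map \<open>x \<mapsto> u * x + v\<close> modulo
  \<open>n\<close>. An affine map is determined by the images of 0 and 1, so \<open>{0, 1}\<close> is a determining set.
  For the cost, a third vertex \<open>c\<close> is added such that no nontrivial affine automorphism
  permutes \<open>{0, 1, c}\<close>. Such a permutation has slope \<open>\<plusminus> c\<close> or \<open>\<plusminus> (1 - c)\<close>, or it exchanges 0
  and 1 and \<open>2 * c = 1\<close> (\<open>affine_preserving_three_set\<close>). If \<open>i = 1\<close>, then \<open>c = 3\<close> avoids this.
  If neither step is a unit, write \<open>1 = p * i + q * j\<close> and take \<open>c = p * i\<close>: neither \<open>c\<close> nor
  \<open>1 - c\<close> is a unit, but all slopes are.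

  That the automorphisms are affine is seen by counting common neighbours. Let the connection
  set be \<open>{a, -a, b, -b}\<close>. Two neighbours \<open>x + s\<close> and \<open>x + t\<close> of \<open>x\<close> have the common
  neighbours \<open>x\<close> and \<open>x + s + t\<close>, and these coincide if the two neighbours are opposite. If
  there are no accidental common neighbours (\<open>generic_steps\<close>), then an automorphism maps
  opposite neighbours to opposite neighbours and parallelograms to parallelograms, so parallel
  edges have parallel images, and connectedness makes the map affine
  (\<open>generic_symmetry_affine\<close>).

  Accidental common neighbours come from one of the relations \<open>4 * i = 0\<close>, \<open>4 * j = 0\<close>,
  \<open>2 * i = \<plusminus> 2 * j\<close>, \<open>3 * i = \<plusminus> j\<close> and \<open>3 * j = \<plusminus> i\<close> modulo \<open>n\<close>. The argument tolerates the
  first two, one at a time, since it suffices to recognise one of the two pairs of opposite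
  neighbours. The third produces twins. The last two make one of the steps a unit; then
  \<open>i = 1\<close> and the connection set is \<open>{a, -a, 3 * a, -3 * a}\<close> for a unit \<open>a\<close>. For \<open>n \<le> 6\<close> and
  for \<open>n = 8\<close> there are twins. For all other \<open>n \<noteq> 10\<close>, the edges of the Hamiltonian cycle with
  step \<open>a\<close> are then characterised by their numbers of common neighbours, and the automorphism
  group is dihedral (\<open>triple_symmetry_affine\<close>).\<close>

section \<open>Symmetries of the connection set modulo n\<close>

text \<open>The connection set \<open>{a, -a, b, -b}\<close> of the Cayley graph, modulo \<open>n\<close>. Working with all
  integers and divisibility by \<open>n\<close> instead of representatives keeps the vertex arithmetic free
  of reductions.\<close>

definition is_step :: "int \<Rightarrow> int \<Rightarrow> int \<Rightarrow> int \<Rightarrow> bool" where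
  "is_step n a b d \<longleftrightarrow> n dvd d - a \<or> n dvd d + a \<or> n dvd d - b \<or> n dvd d + b"

lemma is_step_cong:
  assumes "n dvd d - e"
  shows "is_step n a b d \<longleftrightarrow> is_step n a b e"
  using assms unfolding is_step_def by (smt (verit) dvd_diff dvd_add)

lemma is_step_swap: "is_step n b a = is_step n a b"
  by (auto simp: is_step_def fun_eq_iff)

lemma is_step_uminus: "is_step n a (- b) = is_step n a b" "is_step n (- a) b = is_step n a b"
  by (auto simp: is_step_def fun_eq_iff)

lemma is_step_minus: "is_step n a b (- d) = is_step n a b d"
  unfolding is_step_def by (smt (verit) dvd_minus_iff)

text \<open>An automorphism of the circulant graph, lifted to all integers by periodicity.\<close>

locale circulant_symmetry =
  fixes n a b :: int and F :: "int \<Rightarrow> int"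
  assumes inj: "n dvd F x - F y \<longleftrightarrow> n dvd x - y"
    and surj: "\<exists>x. n dvd F x - y"
    and step_iff: "is_step n a b (F x - F y) \<longleftrightarrow> is_step n a b (x - y)"

lemma iterated_shift:
  assumes "\<And>x. n dvd F (x + a) - F x - (A :: int)"
  shows "n dvd F (x + k * a) - F x - k * A"
proof (induction k rule: int_induct[where k = 0])
  case base
  show ?case by simp
next
  case (step1 k)
  show ?case
    using dvd_add[OF step1(2) assms[of "x + k * a"]] by (simp add: algebra_simps)
next
  case (step2 k)
  show ?case
    using dvd_diff[OF step2(2) assms[of "x + (k - 1) * a"]] by (simp add: algebra_simps)
qed

text \<open>Adding 1 amounts to \<open>p\<close> steps by \<open>a\<close> and \<open>q\<close> steps by \<open>b\<close>, so it changes \<open>F\<close> by a constant,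
  which is then the slope. With \<open>A = B = 0\<close> the lemma also says that a function invariant
  under both steps is constant; it is used in this form for the increments of a symmetry.\<close>

lemma affine_if_steps_constant:
  fixes F :: "int \<Rightarrow> int"
  assumes resp: "\<And>x y. n dvd x - y \<Longrightarrow> n dvd F x - F y"
    and A: "\<And>x. n dvd F (x + a) - F x - A"
    and B: "\<And>x. n dvd F (x + b) - F x - B"
    and gen: "n dvd p * a + q * b - 1"
  shows "n dvd F x - ((p * A + q * B) * x + F 0)"
proof -
  have "n dvd F (y + 1) - F y - (p * A + q * B)" for y
  proof -
    have 1: "n dvd F (y + p * a + q * b) - F (y + 1)"
      by (rule resp) (use gen in \<open>simp add: algebra_simps\<close>)
    have 2: "n dvd F (y + p * a) - F y - p * A"
      by (rule iterated_shift) (rule A)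
    have 3: "n dvd F (y + p * a + q * b) - F (y + p * a) - q * B"
      by (rule iterated_shift) (rule B)
    show ?thesis
      using dvd_diff[OF dvd_add[OF 2 3] 1] by (simp add: algebra_simps)
  qed
  then have "n dvd F (0 + x * 1) - F 0 - x * (p * A + q * B)"
    by (rule iterated_shift)
  then show ?thesis
    by (simp add: algebra_simps)
qed

section \<open>Connection sets without accidental 4-cycles\<close>

text \<open>Every abelian Cayley graph has the 4-cycles \<open>x, x + s, x + s + t, x + t\<close>. The conditions
  exclude all other 4-cycles, except those with four steps by \<open>b\<close>, which exist if \<open>b\<close> has
  order 4. The order of \<open>b\<close> may also be 2; this is the case of the cubic graphs.\<close>

locale generic_steps =
  fixes n a b :: int
  assumes four: "\<not> n dvd 4 * a"
    and two: "\<not> n dvd 2 * a - 2 * b" "\<not> n dvd 2 * a + 2 * b"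
    and three: "\<not> n dvd 3 * a - b" "\<not> n dvd 3 * a + b" "\<not> n dvd 3 * b - a" "\<not> n dvd 3 * b + a"
begin

lemma basic: "\<not> n dvd 2 * a" "\<not> n dvd a - b" "\<not> n dvd a + b"
  using four two by (smt (verit) dvd_add)+

text \<open>The vertices \<open>a\<close> and \<open>-a\<close> have no common neighbour besides 0: any other one would be a
  coincidence between two sums of two steps, and each of these is excluded.\<close>

lemma common_neighbour_opposite:
  assumes "is_step n a b (z - a)" "is_step n a b (z + a)"
  shows "n dvd z"
  using assms four two three basic unfolding is_step_def by (smt (verit) dvd_diff dvd_add)

lemma common_neighbour_ab:
  assumes "is_step n a b (z - a)" "is_step n a b (z - b)"
  shows "n dvd z \<or> n dvd z - a - b"
  using assms four two three basic unfolding is_step_def by (smt (verit) dvd_diff dvd_add)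

end

lemma (in generic_steps) generic_steps_uminus: "generic_steps n a (- b)" "generic_steps n (- a) b"
  using four two three by (unfold_locales; smt (verit) dvd_minus_iff)+

context generic_steps begin

text \<open>Two neighbours of 0 that are neither equal nor opposite are some \<open>\<plusminus> a\<close> and some \<open>\<plusminus> b\<close>. The
  conditions on the connection set do not change if \<open>a\<close> or \<open>b\<close> is negated, so the case of \<open>a\<close>
  and \<open>b\<close> suffices.\<close>

lemma fourth_vertex_of_square:
  assumes "is_step n a b A" "is_step n a b B" "is_step n a b (Z - A)" "is_step n a b (Z - B)"
    and "\<not> n dvd A - B" "\<not> n dvd A + B" "\<not> n dvd Z"
  shows "n dvd Z - A - B"
proof -
  have pm: "generic_steps n (e * a) (f * b) \<and> is_step n (e * a) (f * b) = is_step n a b"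
    if "e \<in> {1, -1}" "f \<in> {1, -1}" for e f
    using that generic_steps_uminus generic_steps_axioms generic_steps.generic_steps_uminus
    by (auto simp: is_step_uminus)
  have *: "n dvd Z - C - D" if ef: "e \<in> {1, -1}" "f \<in> {1, -1}" "n dvd C - e * a" "n dvd D - f * b"
    and st: "is_step n a b (Z - C)" "is_step n a b (Z - D)" for e f C D
  proof -
    interpret ef: generic_steps n "e * a" "f * b"
      using pm[of e f] ef by blast
    have "n dvd Z - e * a - f * b"
      using ef.common_neighbour_ab[of Z] pm[of e f] ef st assms(7)
        is_step_cong[of n "Z - C" "Z - e * a"] is_step_cong[of n "Z - D" "Z - f * b"]
      by (smt (verit) dvd_diff dvd_minus_iff)
    then show ?thesis
      using ef(3,4) by (smt (verit) dvd_diff)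
  qed
  consider e f where "e \<in> {1, -1}" "f \<in> {1, -1}" "n dvd A - e * a" "n dvd B - f * b"
    | e f where "e \<in> {1, -1}" "f \<in> {1, -1}" "n dvd B - e * a" "n dvd A - f * b"
  proof -
    have cases: "(\<exists>e \<in> {1, -1}. n dvd C - e * a) \<or> (\<exists>f \<in> {1, -1}. n dvd C - f * b)"
      if "is_step n a b C" for C
      using that by (auto simp: is_step_def)
    have nonparallel: False
      if "e \<in> {1, -1}" "f \<in> {1, -1}" "n dvd A - e * c" "n dvd B - f * c" for c e f
    proof -
      from that(1,2) have "f = e \<or> f = - e"
        by auto
      then show False
        using dvd_diff[OF that(3,4)] dvd_add[OF that(3,4)] assms(5,6) by auto
    qed
    from cases[OF assms(1)] cases[OF assms(2)] show ?thesis
      by - (elim disjE bexE;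
        (erule (3) nonparallel[THEN FalseE] | erule (3) that(1) | erule (3) that(2)))
  qed
  then show ?thesis
  proof cases
    case 1
    then show ?thesis using *[of _ _ A B] assms(3,4) by blast
  next
    case 2
    then have "n dvd Z - B - A" using *[of _ _ B A] assms(3,4) by blast
    then show ?thesis by (simp add: algebra_simps)
  qed
qed

end

locale generic_symmetry = circulant_symmetry + generic_steps
begin

text \<open>Opposite neighbours of a vertex go to opposite neighbours of its image. Pull the pair
  \<open>F x + a\<close>, \<open>F x - a\<close> back to neighbours \<open>p\<close>, \<open>q\<close> of \<open>x\<close>. Their only common neighbour is \<open>x\<close>,
  but \<open>p + q - x\<close> is one as well; hence \<open>p + q = 2 * x\<close>, and \<open>p\<close>, \<open>q\<close> are opposite. The
  remaining neighbours of \<open>x\<close> go to \<open>F x + b\<close> and \<open>F x - b\<close>, which are opposite too.\<close>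

lemma preserves_midpoints:
  "n dvd F (x + a) + F (x - a) - 2 * F x" "n dvd F (x + b) + F (x - b) - 2 * F x"
proof -
  obtain p q where p: "n dvd F p - (F x + a)" and q: "n dvd F q - (F x - a)"
    using surj by metis
  have "is_step n a b (F p - F x)" "is_step n a b (F q - F x)"
    using p q by (auto simp: is_step_def algebra_simps)
  then have stp: "is_step n a b (p - x)" and stq: "is_step n a b (q - x)"
    by (simp_all add: step_iff)
  have "n dvd z - x" if "is_step n a b (z - p)" "is_step n a b (z - q)" for z
  proof -
    have "is_step n a b (F z - F p)" "is_step n a b (F z - F q)"
      using that by (simp_all add: step_iff)
    moreover have "n dvd (F z - F p) - ((F z - F x) - a)" "n dvd (F z - F q) - ((F z - F x) + a)"
      using p q by (simp_all add: dvd_diff_commute algebra_simps)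
    ultimately have "is_step n a b ((F z - F x) - a)" "is_step n a b ((F z - F x) + a)"
      using is_step_cong by blast+
    then show ?thesis
      using common_neighbour_opposite inj by blast
  qed
  from this[of "p + q - x"] have pq: "n dvd p + q - 2 * x"
    using stp stq by (simp add: algebra_simps)
  have "\<exists>c \<in> {a, - a, b, - b}. n dvd p - (x + c)"
    using stp by (auto simp: is_step_def algebra_simps)
  then obtain c where c: "c \<in> {a, - a, b, - b}" and pc: "n dvd p - (x + c)"
    by blast
  have qc: "n dvd q - (x - c)"
    using dvd_diff[OF pq pc] by (simp add: algebra_simps)
  have Fp: "n dvd F (x + c) - F x - a"
    using dvd_diff[OF p, of "F p - F (x + c)"] pc by (simp add: inj) (simp add: algebra_simps)
  have Fq: "n dvd F (x - c) - F x + a"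
    using dvd_diff[OF q, of "F q - F (x - c)"] qc by (simp add: inj) (simp add: algebra_simps)
  have mid_c: "n dvd F (x + c) + F (x - c) - 2 * F x"
    using dvd_add[OF Fp Fq] by (simp add: algebra_simps)
  \<comment> \<open>The images of the two neighbours other than \<open>x + c\<close> and \<open>x - c\<close> have no choice but \<open>F x + b\<close> and \<open>F x - b\<close>.\<close>
  have to_b: "n dvd F (x + d) - F x - b \<or> n dvd F (x + d) - F x + b"
    if d: "d \<in> {a, - a, b, - b}" and "\<not> n dvd d - c" "\<not> n dvd d + c" for d
  proof -
    have "\<not> n dvd F (x + d) - F (x + c)" "\<not> n dvd F (x + d) - F (x - c)"
      using that by (simp_all add: inj)
    then have "\<not> n dvd F (x + d) - F x - a" "\<not> n dvd F (x + d) - F x + a"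
      using dvd_diff[OF _ Fp, of "F (x + d) - F x - a"] dvd_diff[OF _ Fq, of "F (x + d) - F x + a"]
      by auto
    moreover have "is_step n a b (F (x + d) - F x)"
      unfolding step_iff using d by (auto simp: is_step_def)
    ultimately show ?thesis
      by (simp add: is_step_def)
  qed
  have mid_d: "n dvd F (x + d) + F (x - d) - 2 * F x"
    if d: "d \<in> {a, - a, b, - b}" and nc: "\<not> n dvd d - c" "\<not> n dvd d + c"
      and that_d: "n dvd 2 * d \<Longrightarrow> n dvd 2 * b" for d
  proof -
    have "\<not> n dvd - d - c" "\<not> n dvd - d + c"
      using nc dvd_minus_iff[of n "- d - c"] dvd_minus_iff[of n "- d + c"] by (auto simp: algebra_simps)
    then have 1: "n dvd F (x - d) - F x - b \<or> n dvd F (x - d) - F x + b"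
      using to_b[of "- d"] d by auto
    have 2: "n dvd F (x + d) - F x - b \<or> n dvd F (x + d) - F x + b"
      using to_b d nc by blast
    have 3: "n dvd 2 * b" if "n dvd F (x + d) - F (x - d)"
      using that that_d by (simp add: inj)
    \<comment> \<open>If both neighbours have the same image, then \<open>2 * b = 0\<close> and the sum is still right.\<close>
    have eq: "n dvd u + v" if uv: "n dvd u - b \<or> n dvd u + b" "n dvd v - b \<or> n dvd v + b"
      "n dvd u - v \<Longrightarrow> n dvd 2 * b" for u v
    proof -
      consider "n dvd u - b" "n dvd v - b" | "n dvd u + b" "n dvd v + b"
        | "n dvd u + v"
        using uv dvd_add[of n "u - b" "v + b"] dvd_add[of n "u + b" "v - b"] by auto
      then show ?thesis
      proof cases
        case 1
        then have "n dvd 2 * b"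
          using uv(3) dvd_diff[of n "u - b" "v - b"] by simp
        then show ?thesis
          using dvd_add[OF 1] dvd_add[of n "u - b + (v - b)" "2 * b"] by simp
      next
        case 2
        then have "n dvd 2 * b"
          using uv(3) dvd_diff[of n "u + b" "v + b"] by simp
        then show ?thesis
          using dvd_add[OF 2] dvd_diff[of n "u + b + (v + b)" "2 * b"] by simp
      qed
    qed
    show ?thesis
      using eq[OF 2 1] 3 by (simp add: algebra_simps)
  qed
  have "\<not> n dvd b - a" "\<not> n dvd - a - b"
    using basic dvd_minus_iff[of n "a - b"] dvd_minus_iff[of n "a + b"] by (simp_all add: algebra_simps)
  note nd = basic this
  consider "c = a \<or> c = - a" | "c = b \<or> c = - b"
    using c by blast
  then show "n dvd F (x + a) + F (x - a) - 2 * F x" "n dvd F (x + b) + F (x - b) - 2 * F x"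
    using mid_c mid_d[of a] mid_d[of b] nd by (cases; auto simp: algebra_simps)+
qed

text \<open>The fourth vertex of the square at \<open>x\<close> with sides \<open>a\<close> and \<open>b\<close> is a common neighbour of the
  images of \<open>x + a\<close> and \<open>x + b\<close> different from \<open>F x\<close>. These images are not opposite: the
  vertex opposite to \<open>F (x + a)\<close> is \<open>F (x - a)\<close>. So they span a unique square.\<close>

lemma preserves_parallelograms: "n dvd F (x + a + b) - F (x + a) - F (x + b) + F x"
proof -
  have "\<not> n dvd (F (x + a) - F x) + (F (x + b) - F x)"
  proof
    assume "n dvd (F (x + a) - F x) + (F (x + b) - F x)"
    with preserves_midpoints(1)[of x] have "n dvd F (x + b) - F (x - a)"
      by (smt (verit) dvd_diff)
    then show False
      using basic(3) by (simp add: inj algebra_simps)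
  qed
  moreover have "is_step n a b (F (x + a) - F x)" "is_step n a b (F (x + b) - F x)"
    "is_step n a b ((F (x + a + b) - F x) - (F (x + a) - F x))"
    "is_step n a b ((F (x + a + b) - F x) - (F (x + b) - F x))"
    by (simp_all add: step_iff) (simp_all add: is_step_def)
  moreover have "\<not> n dvd (F (x + a) - F x) - (F (x + b) - F x)" "\<not> n dvd F (x + a + b) - F x"
    using basic by (simp_all add: inj algebra_simps)
  ultimately have "n dvd (F (x + a + b) - F x) - (F (x + a) - F x) - (F (x + b) - F x)"
    by (intro fourth_vertex_of_square) auto
  then show ?thesis
    by (simp add: algebra_simps)
qed

text \<open>Midpoints and parallelograms together say that the increments \<open>F (x + a) - F x\<close> and
  \<open>F (x + b) - F x\<close> do not change when \<open>x\<close> moves by \<open>a\<close> or \<open>b\<close>. If \<open>a\<close> and \<open>b\<close> generate, these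
  increments are constant.\<close>

lemma generic_symmetry_affine:
  assumes gen: "n dvd p * a + q * b - 1"
  shows "\<exists>u. \<forall>x. n dvd F x - (u * x + F 0)"
proof -
  have resp: "n dvd F (x + d) - F x - (F (y + d) - F y)" if "n dvd x - y" for d x y
    using dvd_diff[of n "F (x + d) - F (y + d)" "F x - F y"] that
    by (simp add: inj algebra_simps)
  have aa: "n dvd F (x + a + a) - F (x + a) - (F (x + a) - F x) - 0" for x
    using preserves_midpoints(1)[of "x + a"] by (simp add: algebra_simps)
  have ab: "n dvd F (x + b + a) - F (x + b) - (F (x + a) - F x) - 0" for x
    using preserves_parallelograms[of x] by (simp add: algebra_simps)
  have bb: "n dvd F (x + b + b) - F (x + b) - (F (x + b) - F x) - 0" for x
    using preserves_midpoints(2)[of "x + b"] by (simp add: algebra_simps)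
  have ba: "n dvd F (x + a + b) - F (x + a) - (F (x + b) - F x) - 0" for x
    using preserves_parallelograms[of x] by (simp add: algebra_simps)
  have A: "n dvd F (x + a) - F x - (F (0 + a) - F 0)" for x
    using affine_if_steps_constant[OF resp aa ab gen, of x] by simp
  have B: "n dvd F (x + b) - F x - (F (0 + b) - F 0)" for x
    using affine_if_steps_constant[OF resp ba bb gen, of x] by simp
  show ?thesis
    using affine_if_steps_constant[OF _ A B gen] inj by blast
qed

end


section \<open>Connection sets in which one step is three times the other\<close>

text \<open>With connection set \<open>{a, -a, 3 * a, -3 * a}\<close> the vertices \<open>a\<close> and \<open>-a\<close> have three common
  neighbours, and so do \<open>a\<close> and \<open>3 * a\<close>, so the reasoning with unique squares breaks down.
  Further common neighbours arise if \<open>k * a\<close> vanishes for an even \<open>k\<close> up to 12. The conditions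
  exclude this for \<open>k \<le> 10\<close>, as 2 and 4 divide 8. The remaining coincidence \<open>6 * a = -6 * a\<close>
  adds one common neighbour of \<open>3 * a\<close> and \<open>-3 * a\<close>, too few to disturb the counting below.\<close>

locale triple_steps =
  fixes n a :: int
  assumes six: "\<not> n dvd 6 * a" and eight: "\<not> n dvd 8 * a" and ten: "\<not> n dvd 10 * a"
begin

lemma two_four: "\<not> n dvd 2 * a" "\<not> n dvd 4 * a"
  using eight dvd_mult[of n "2 * a" 4] dvd_mult[of n "4 * a" 2] by auto

lemma common_neighbour_3_m1:
  assumes "is_step n a (3 * a) (z - 3 * a)" "is_step n a (3 * a) (z + a)"
  shows "n dvd z \<or> n dvd z - 2 * a"
  using assms six eight ten two_four unfolding is_step_def by (smt (verit) dvd_diff)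

lemma common_neighbour_3_m3:
  assumes "is_step n a (3 * a) (z - 3 * a)" "is_step n a (3 * a) (z + 3 * a)"
  shows "n dvd z \<or> n dvd z - 6 * a"
  using assms six eight ten two_four unfolding is_step_def by (smt (verit) dvd_diff)

lemma triple_steps_uminus: "triple_steps n (- a)"
  using six eight ten by unfold_locales auto

text \<open>Among the neighbours of 0, only \<open>a\<close> shares three neighbours with \<open>3 * a\<close>: besides 0, each
  of \<open>-a\<close> and \<open>-3 * a\<close> shares at most one more.\<close>

lemma no_three_common_neighbours_pos:
  assumes w: "n dvd w - 3 * a"
    and t: "is_step n a (3 * a) t" "\<not> n dvd t - w" "\<not> n dvd t - a"
    and z: "is_step n a (3 * a) (z - w)" "is_step n a (3 * a) (z - t)" "\<not> n dvd z"
    and z': "is_step n a (3 * a) (z' - w)" "is_step n a (3 * a) (z' - t)" "\<not> n dvd z'"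
  shows "n dvd z - z'"
proof -
  have "is_step n a (3 * a) (y - 3 * a)" if "is_step n a (3 * a) (y - w)" for y
    using is_step_cong[of n "y - w" "y - 3 * a"] w that by (simp add: dvd_diff_commute)
  note zw = this[OF z(1)] this[OF z'(1)]
  have "\<not> n dvd t - 3 * a"
    using t(2) dvd_diff[OF _ w, of "t - 3 * a"] by auto
  then consider "n dvd t + a" | "n dvd t + 3 * a"
    using t by (auto simp: is_step_def)
  then show ?thesis
  proof cases
    case 1
    then have "is_step n a (3 * a) (y + a)" if "is_step n a (3 * a) (y - t)" for y
      using is_step_cong[of n "y - t" "y + a"] dvd_minus_iff[of n "t + a"] that by (simp add: algebra_simps)
    from common_neighbour_3_m1[OF zw(1) this[OF z(2)]] common_neighbour_3_m1[OF zw(2) this[OF z'(2)]]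
    show ?thesis
      using z(3) z'(3) dvd_diff[of n "z - 2 * a" "z' - 2 * a"] by auto
  next
    case 2
    then have "is_step n a (3 * a) (y + 3 * a)" if "is_step n a (3 * a) (y - t)" for y
      using is_step_cong[of n "y - t" "y + 3 * a"] dvd_minus_iff[of n "t + 3 * a"] that
      by (simp add: algebra_simps)
    from common_neighbour_3_m3[OF zw(1) this[OF z(2)]] common_neighbour_3_m3[OF zw(2) this[OF z'(2)]]
    show ?thesis
      using z(3) z'(3) dvd_diff[of n "z - 6 * a" "z' - 6 * a"] by auto
  qed
qed

lemma no_three_common_neighbours:
  assumes e: "e \<in> {1, -1}" and w: "n dvd w - 3 * (e * a)"
    and t: "is_step n a (3 * a) t" "\<not> n dvd t - w" "\<not> n dvd t - e * a"
    and z: "is_step n a (3 * a) (z - w)" "is_step n a (3 * a) (z - t)" "\<not> n dvd z"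
    and z': "is_step n a (3 * a) (z' - w)" "is_step n a (3 * a) (z' - t)" "\<not> n dvd z'"
  shows "n dvd z - z'"
proof -
  interpret e: triple_steps n "e * a"
    using e triple_steps_uminus triple_steps_axioms by auto
  have "is_step n (e * a) (3 * (e * a)) = is_step n a (3 * a)"
    using e by (auto simp: is_step_uminus)
  with e.no_three_common_neighbours_pos[of w t z z'] assms show ?thesis
    by simp
qed

end

locale triple_symmetry = circulant_symmetry n a "3 * a" F + triple_steps n a for n a F
begin

text \<open>An edge \<open>x, x + a\<close> is recognised by counting: two further neighbours of \<open>x\<close>, namely \<open>x - a\<close>
  and \<open>x + 3 * a\<close>, have three common neighbours with \<open>x + a\<close>. For an edge of the form
  \<open>y, y + 3 * a\<close> there is only one such neighbour of \<open>y\<close>, namely \<open>y + a\<close>.\<close>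

lemma preserves_short_steps: "n dvd F (x + a) - F x - a \<or> n dvd F (x + a) - F x + a"
proof (rule ccontr)
  assume *: "\<not> ?thesis"
  define S where "S = is_step n a (3 * a)"
  have S: "S (F y - F z) \<longleftrightarrow> S (y - z)" for y z
    by (simp add: S_def step_iff)
  have steps: "S a" "S (- a)" "S (3 * a)" "S (- (3 * a))"
    by (simp_all add: S_def is_step_def)
  let ?w = "F (x + a) - F x" and ?P = "F (x - a) - F x" and ?Q = "F (x + 3 * a) - F x"
    and ?z = "F (x + 2 * a) - F x"
  have "S ?w"
    using steps by (simp add: S)
  with * have "\<exists>e\<in>{1, - 1}. n dvd ?w - 3 * (e * a)"
    by (simp add: S_def is_step_def)
  then obtain e where e: "e \<in> {1, -1}" and w: "n dvd ?w - 3 * (e * a)"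
    by blast
  have nd: "\<not> n dvd - (2 * a)" "\<not> n dvd - (4 * a)" "\<not> n dvd 2 * a" "\<not> n dvd 4 * a"
    using two_four by (simp_all only: dvd_minus_iff not_False_eq_True)
  \<comment> \<open>The three common neighbours of \<open>x - a\<close> and \<open>x + a\<close> are \<open>x\<close>, \<open>x + 2 * a\<close> and \<open>x - 2 * a\<close>.\<close>
  have P: "n dvd ?P - e * a"
  proof (rule ccontr)
    assume "\<not> n dvd ?P - e * a"
    moreover have "S ?P" "S (?z - ?w)" "S (?z - ?P)"
      "S (F (x - 2 * a) - F x - ?w)" "S (F (x - 2 * a) - F x - ?P)"
      using steps by (simp_all add: S)
    moreover have "\<not> n dvd ?P - ?w" "\<not> n dvd ?z" "\<not> n dvd F (x - 2 * a) - F x"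
      using nd by (simp_all add: inj)
    ultimately have "n dvd ?z - (F (x - 2 * a) - F x)"
      unfolding S_def by (intro no_three_common_neighbours[OF e w])
    then show False
      using nd by (simp add: inj)
  qed
  \<comment> \<open>The three common neighbours of \<open>x + 3 * a\<close> and \<open>x + a\<close> are \<open>x\<close>, \<open>x + 2 * a\<close> and \<open>x + 4 * a\<close>.\<close>
  have Q: "n dvd ?Q - e * a"
  proof (rule ccontr)
    assume "\<not> n dvd ?Q - e * a"
    moreover have "S ?Q" "S (?z - ?w)" "S (?z - ?Q)"
      "S (F (x + 4 * a) - F x - ?w)" "S (F (x + 4 * a) - F x - ?Q)"
      using steps by (simp_all add: S)
    moreover have "\<not> n dvd ?Q - ?w" "\<not> n dvd ?z" "\<not> n dvd F (x + 4 * a) - F x"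
      using nd by (simp_all add: inj)
    ultimately have "n dvd ?z - (F (x + 4 * a) - F x)"
      unfolding S_def by (intro no_three_common_neighbours[OF e w])
    then show False
      using nd by (simp add: inj)
  qed
  show False
    using dvd_diff[OF P Q] nd by (simp add: inj)
qed

text \<open>The steps by \<open>a\<close> form a Hamiltonian cycle that every symmetry preserves, so the symmetries
  are rotations and reflections of this cycle.\<close>

lemma triple_symmetry_affine:
  assumes gen: "n dvd p * a - 1"
  shows "\<exists>u. (n dvd u - 1 \<or> n dvd u + 1) \<and> (\<forall>x. n dvd F x - (u * x + F 0))"
proof -
  have resp: "n dvd F (x + d) - F x - (F (y + d) - F y)" if "n dvd x - y" for d x y
    using dvd_diff[of n "F (x + d) - F (y + d)" "F x - F y"] that
    by (simp add: inj algebra_simps)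
  \<comment> \<open>The walk cannot turn back, since \<open>x\<close> and \<open>x + 2 * a\<close> have different images.\<close>
  have turn: "n dvd F (x + a + a) - F (x + a) - (F (x + a) - F x) - 0" for x
  proof -
    have "\<not> n dvd F (x + a + a) - F x"
      using two_four by (simp add: inj)
    with preserves_short_steps[of x] preserves_short_steps[of "x + a"] show ?thesis
      using dvd_add[of n "F (x + a + a) - F (x + a) - a" "F (x + a) - F x + a"]
        dvd_add[of n "F (x + a + a) - F (x + a) + a" "F (x + a) - F x - a"]
        dvd_diff[of n "F (x + a + a) - F (x + a) - a" "F (x + a) - F x - a"]
        dvd_diff[of n "F (x + a + a) - F (x + a) + a" "F (x + a) - F x + a"]
      by auto
  qed
  have gen0: "n dvd p * a + 0 * 0 - 1"
    using gen by simp
  have A: "n dvd F (x + a) - F x - (F (0 + a) - F 0)" for x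
    using affine_if_steps_constant[where F = "\<lambda>x. F (x + a) - F x" and A = 0 and b = 0 and B = 0,
        OF resp turn _ gen0, of x] by simp
  have "n dvd F x - ((p * (F (0 + a) - F 0)) * x + F 0)" for x
    using affine_if_steps_constant[where F = F and A = "F (0 + a) - F 0" and b = 0 and B = 0,
        OF _ A _ gen0, of x] inj by simp
  moreover have "n dvd p * (F (0 + a) - F 0) - 1 \<or> n dvd p * (F (0 + a) - F 0) + 1"
    using preserves_short_steps[of 0]
  proof
    assume "n dvd F (0 + a) - F 0 - a"
    from dvd_add[OF dvd_mult[OF this, of p] gen] show ?thesis
      by (simp add: algebra_simps)
  next
    assume "n dvd F (0 + a) - F 0 + a"
    from dvd_diff[OF dvd_mult[OF this, of p] gen] show ?thesis
      by (simp add: algebra_simps)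
  qed
  ultimately show ?thesis
    by blast
qed

end

section \<open>Automorphisms of circulant graphs\<close>

lemma pverts_circulant [simp]: "pverts (circulant n i j) = {0..n - 1}"
  by (simp add: circulant_def carrier_residue_ring)

lemma parcs_circulant_iff:
  "(x, y) \<in> parcs (circulant n i j) \<longleftrightarrow>
     x \<in> {0..n - 1} \<and> y \<in> {0..n - 1} \<and> is_step n i j (x - y)"
  by (simp add: circulant_def carrier_residue_ring is_step_def cong_iff_dvd_diff)

lemma eq_if_dvd_diff:
  assumes "x \<in> {0..n - 1}" "y \<in> {0..n - 1}" "n dvd x - (y :: int)"
  shows "x = y"
  using assms by (simp add: mod_eq_dvd_iff[symmetric])

lemma automorphism_permutes: "f \<in> automorphisms (circulant n i j) \<Longrightarrow> f permutes {0..n - 1}"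
  by (simp add: automorphisms_def)

lemma circulant_symmetry_automorphism:
  assumes "0 < n" and f: "f \<in> automorphisms (circulant n i j)"
  shows "circulant_symmetry n i j (\<lambda>x. f (x mod n))"
proof
  have p: "f permutes {0..n - 1}"
    using f by (rule automorphism_permutes)
  have V: "x mod n \<in> {0..n - 1}" for x
    using \<open>0 < n\<close> by (simp add: pos_mod_bound zle_diff1_eq)
  have fV: "f (x mod n) \<in> {0..n - 1}" for x
    using V permutes_in_image[OF p] by blast
  show "n dvd f (x mod n) - f (y mod n) \<longleftrightarrow> n dvd x - y" for x y
  proof -
    have "n dvd f (x mod n) - f (y mod n) \<longleftrightarrow> f (x mod n) = f (y mod n)"
      using eq_if_dvd_diff[OF fV fV] by auto
    also have "\<dots> \<longleftrightarrow> x mod n = y mod n"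
      using permutes_inj[OF p] by (simp add: inj_eq)
    finally show ?thesis
      by (simp add: mod_eq_dvd_iff)
  qed
  show "\<exists>x. n dvd f (x mod n) - y" for y
  proof -
    obtain x where x: "x \<in> {0..n - 1}" "f x = y mod n"
      using permutes_image[OF p] V[of y] by (metis imageE)
    then have "f (x mod n) = y mod n"
      by simp
    then show ?thesis
      by (metis dvd_minus_mod dvd_diff_commute)
  qed
  show "is_step n i j (f (x mod n) - f (y mod n)) \<longleftrightarrow> is_step n i j (x - y)" for x y
  proof -
    have "(f (x mod n), f (y mod n)) \<in> parcs (circulant n i j)
        \<longleftrightarrow> (x mod n, y mod n) \<in> parcs (circulant n i j)"
      using f V[of x] V[of y] unfolding automorphisms_def pverts_circulant by blast
    then have "is_step n i j (f (x mod n) - f (y mod n)) \<longleftrightarrow> is_step n i j (x mod n - y mod n)"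
      using V fV by (simp only: parcs_circulant_iff simp_thms)
    also have "\<dots> \<longleftrightarrow> is_step n i j (x - y)"
      by (rule is_step_cong) (simp add: mod_eq_dvd_iff[symmetric] mod_diff_eq)
    finally show ?thesis .
  qed
qed

text \<open>The reflections exist in every circulant graph and give all lower bounds. The map is the
  identity outside of the vertex set, as the automorphisms are.\<close>

definition reflection :: "int \<Rightarrow> int \<Rightarrow> int \<Rightarrow> int" where
  "reflection n s x = (if x \<in> {0..n - 1} then (s - x) mod n else x)"

lemma reflection_reflection: "reflection n s (reflection n s x) = x"
  if "0 < n"
  using that by (cases "x \<in> {0..n - 1}") (auto simp: reflection_def mod_simps pos_mod_bound zle_diff1_eq)

lemma reflection_automorphism:
  assumes "0 < n"
  shows "reflection n s \<in> automorphisms (circulant n i j)"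
proof -
  have V: "reflection n s x \<in> {0..n - 1}" if "x \<in> {0..n - 1}" for x
    using that assms by (simp add: reflection_def pos_mod_bound zle_diff1_eq)
  have "bij_betw (reflection n s) {0..n - 1} {0..n - 1}"
    using V reflection_reflection[OF assms] by (intro bij_betw_byWitness[where f' = "reflection n s"]) auto
  then have "reflection n s permutes {0..n - 1}"
    by (rule bij_imp_permutes) (auto simp: reflection_def)
  moreover have "is_step n i j (reflection n s x - reflection n s y) \<longleftrightarrow> is_step n i j (x - y)"
    if "x \<in> {0..n - 1}" "y \<in> {0..n - 1}" for x y
  proof -
    have "is_step n i j (reflection n s x - reflection n s y) \<longleftrightarrow> is_step n i j (- (x - y))"
    proof (rule is_step_cong)
      have "((s - x) mod n - (s - y) mod n) mod n = (- (x - y)) mod n"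
        by (simp add: mod_diff_eq)
      then show "n dvd reflection n s x - reflection n s y - - (x - y)"
        using that by (simp only: reflection_def if_True mod_eq_dvd_iff)
    qed
    then show ?thesis
      by (simp only: is_step_minus)
  qed
  ultimately show ?thesis
    using V by (simp add: automorphisms_def parcs_circulant_iff del: atLeastAtMost_iff)
qed

lemma reflection_neq_id:
  assumes "2 < n"
  shows "reflection n s \<noteq> id"
proof
  assume *: "reflection n s = id"
  have "s mod n = 0 mod n" "(s - 1) mod n = 1 mod n"
    using fun_cong[OF *, of 0] fun_cong[OF *, of 1] assms by (simp_all add: reflection_def)
  then have "n dvd s" "n dvd s - 1 - 1"
    unfolding mod_eq_dvd_iff by simp_all
  then have "n dvd 2"
    using dvd_diff[of n s "s - 1 - 1"] by simp
  then show False
    using assms zdvd_imp_le by fastforce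
qed

text \<open>The reflection with parameter \<open>a + b\<close> swaps \<open>a\<close> and \<open>b\<close>; for \<open>a = b\<close> it fixes this vertex.\<close>

lemma reflection_preserving_pair:
  assumes "0 < n" "P \<subseteq> {0..n - 1}" "card P \<le> 2"
  shows "\<exists>s. reflection n s ` P = P"
proof -
  have "finite P"
    using assms(2) finite_subset by blast
  then consider "P = {}" | a b where "P = {a, b}"
    using assms(3) by (metis card_0_eq card_1_singletonE card_2_iff insert_absorb2 le_Suc_eq le_zero_eq numeral_2_eq_2 One_nat_def)
  then show ?thesis
  proof cases
    case 2
    then have "reflection n (a + b) ` P = P"
      using assms by (auto simp: reflection_def)
    then show ?thesis ..
  qed auto
qed

text \<open>Every edge stays within one residue class modulo \<open>gcd n (gcd i j)\<close>, so a path from 0 to 1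
  forces this number to be 1.\<close>

lemma connected_circulant_generates:
  assumes "2 \<le> n" and "connected (circulant n i j)"
  shows "\<exists>p q. n dvd p * i + q * j - 1"
proof -
  let ?G = "circulant n i j"
  define d where "d = gcd n (gcd i j)"
  have d: "d dvd n" "d dvd i" "d dvd j"
    unfolding d_def by (meson dvd_trans gcd_dvd1 gcd_dvd2)+
  have "0 \<rightarrow>\<^sup>*\<^bsub>mk_symmetric ?G\<^esub> 1"
    using assms by (auto simp: connected_def strongly_connected_def)
  then have "(0, 1) \<in> (arcs_ends (mk_symmetric ?G))\<^sup>*"
    by (rule reachable_rtranclI)
  then have "d dvd 1 - 0"
  proof (induction rule: rtrancl_induct)
    case (step y z)
    from step(2) have "(y, z) \<in> parcs ?G \<or> (z, y) \<in> parcs ?G"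
      by (auto simp: parcs_mk_symmetric)
    then have "is_step n i j (y - z) \<or> is_step n i j (z - y)"
      by (auto simp: parcs_circulant_iff)
    then have "is_step n i j (z - y)"
      using is_step_minus[of n i j "z - y"] by simp
    then have "d dvd z - y"
      unfolding is_step_def using d
      using dvd_trans[OF d(1), of "z - y - i"] dvd_trans[OF d(1), of "z - y + i"]
        dvd_trans[OF d(1), of "z - y - j"] dvd_trans[OF d(1), of "z - y + j"]
      by (auto simp: dvd_add_left_iff dvd_diff_left_iff)
    with step(3) show ?case
      using dvd_add[of d "y - 0" "z - y"] by simp
  qed simp
  then have "d = 1"
    by (simp add: d_def)
  obtain x y where xy: "x * n + y * gcd i j = 1"
    using bezout_int[of n "gcd i j"] \<open>d = 1\<close> d_def by auto
  obtain p q where pq: "p * i + q * j = gcd i j"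
    using bezout_int by blast
  have "y * p * i + y * q * j - 1 = n * (- x)"
    using xy unfolding pq[symmetric] by (simp add: algebra_simps)
  then show ?thesis
    by (metis dvd_triv_left)
qed

section \<open>The invariants of a circulant graph with affine automorphisms\<close>

lemma affine_fixing_0_1:
  fixes f :: "int \<Rightarrow> int"
  assumes f: "f permutes {0..n - 1}" and aff: "\<And>x. x \<in> {0..n - 1} \<Longrightarrow> n dvd f x - (u * x + f 0)"
    and "2 \<le> n" "f 0 = 0" "f 1 = 1"
  shows "f = id"
proof
  fix x
  show "f x = id x"
  proof (cases "x \<in> {0..n - 1}")
    case True
    have "n dvd 1 - u"
      using aff[of 1] assms by simp
    from dvd_diff[OF aff[OF True] dvd_mult2[OF this, of x]] have "n dvd f x - x"
      using assms by (simp add: algebra_simps)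
    then show ?thesis
      using eq_if_dvd_diff[of "f x" n x] True permutes_in_image[OF f] by simp
  next
    case False
    then show ?thesis
      using f by (simp add: permutes_def)
  qed
qed

text \<open>The slope \<open>u\<close> is \<open>f 1 - f 0\<close>. Every way of permuting \<open>0\<close>, \<open>1\<close> and \<open>c\<close> that moves \<open>0\<close> or \<open>1\<close>
  gives it one of the four excluded values, except for the exchange of 0 and 1, which has
  slope -1 and fixes \<open>c\<close> only if \<open>2 * c = 1\<close>.\<close>

lemma affine_preserving_three_set:
  fixes f :: "int \<Rightarrow> int"
  assumes f: "f permutes {0..n - 1}" and aff: "\<And>x. x \<in> {0..n - 1} \<Longrightarrow> n dvd f x - (u * x + f 0)"
    and "2 \<le> n" and c: "c \<in> {0..n - 1}" "c \<noteq> 0" "c \<noteq> 1"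
    and u: "\<not> n dvd u - c" "\<not> n dvd u + c" "\<not> n dvd u - (1 - c)" "\<not> n dvd u + (1 - c)"
    and half: "\<not> n dvd 2 * c - 1"
    and pres: "f ` {0, 1, c} = {0, 1, c}"
  shows "f = id"
proof -
  have inj: "f x = f y \<longleftrightarrow> x = y" for x y
    using permutes_inj[OF f] by (simp add: inj_eq)
  have f1: "n dvd f 1 - (u + f 0)" and fc: "n dvd f c - (u * c + f 0)"
    using aff[of 1] aff[of c] assms(3) c by simp_all
  have f1': "n dvd u + f 0 - f 1"
    using f1 by (simp add: dvd_diff_commute)
  have "f 0 \<in> {0, 1, c}" "f 1 \<in> {0, 1, c}" "f c \<in> {0, 1, c}"
    using pres by blast+
  moreover have "f 0 \<noteq> f 1" "f 0 \<noteq> f c" "f 1 \<noteq> f c"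
    using c by (auto simp: inj)
  ultimately consider "f 0 = 0" "f 1 = 1" | "f 0 = 0" "f 1 = c" | "f 0 = 1" "f 1 = 0" "f c = c"
    | "f 0 = 1" "f 1 = c" | "f 0 = c" "f 1 = 0" | "f 0 = c" "f 1 = 1"
    by auto
  then show ?thesis
  proof cases
    case 1
    then show ?thesis
      using affine_fixing_0_1[OF f aff] assms(3) by blast
  next
    case 3
    have "n dvd (c - (u * c + 1)) + (u + 1) * c"
      using f1' fc 3 by (intro dvd_add) auto
    with half show ?thesis
      by (simp add: algebra_simps)
  qed (use f1' u in \<open>simp_all add: algebra_simps\<close>)
qed


text \<open>The set \<open>{0, 1}\<close> is determining and the colour class \<open>{0, 1, c}\<close> is distinguishing. For the
  lower bounds, a single vertex \<open>a\<close> is fixed by the reflection in \<open>a\<close>, a colouring with one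
  colour is preserved by every automorphism, and a colour class with at most two vertices is
  preserved by a reflection.\<close>

lemma invariants_if_affine:
  fixes n i j c :: int
  assumes n: "3 \<le> n" and c: "c \<in> {0..n - 1}"
    and half: "\<not> n dvd 2 * c - 1"
    and affine: "\<And>f. f \<in> automorphisms (circulant n i j) \<Longrightarrow>
      \<exists>u. (\<forall>x \<in> {0..n - 1}. n dvd f x - (u * x + f 0)) \<and>
        \<not> n dvd u - c \<and> \<not> n dvd u + c \<and> \<not> n dvd u - (1 - c) \<and> \<not> n dvd u + (1 - c)"
  shows "Det (circulant n i j) = 2 \<and> Dist (circulant n i j) = 2 \<and> cost (circulant n i j) = 3"
proof -
  let ?G = "circulant n i j" and ?V = "{0..n - 1}"
  have refl: "reflection n s \<in> automorphisms ?G" "reflection n s \<noteq> id" for s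
    using n by (simp_all add: reflection_automorphism reflection_neq_id)
  have "id \<in> automorphisms ?G"
    by (simp add: automorphisms_def permutes_id)
  \<comment> \<open>The identity has slope 1, which must differ from \<open>c\<close> and from \<open>1 - c\<close>.\<close>
  from affine[OF this] have c01: "c \<noteq> 0" "c \<noteq> 1"
    using n dvd_minus_iff[of n] by (auto 4 4 dest!: bspec[of _ _ 1] simp: dvd_diff_commute)
  have rigid: "f = id" if f: "f \<in> automorphisms ?G" and "f ` {0, 1, c} = {0, 1, c}" for f
  proof -
    obtain u where u: "\<And>x. x \<in> ?V \<Longrightarrow> n dvd f x - (u * x + f 0)"
      and avoid: "\<not> n dvd u - c" "\<not> n dvd u + c" "\<not> n dvd u - (1 - c)" "\<not> n dvd u + (1 - c)"
      using affine[OF f] by blast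
    have "2 \<le> n"
      using n by simp
    from affine_preserving_three_set[OF automorphism_permutes[OF f] u this c c01 avoid half that(2)]
    show ?thesis .
  qed
  have "Det ?G = 2"
    unfolding Det_def
  proof (rule Least_equality)
    have "determining_set ?G {0, 1}"
      unfolding determining_set_def
    proof (intro conjI ballI impI)
      show "{0, 1} \<subseteq> pverts ?G"
        using n by simp
      fix f
      assume f: "f \<in> automorphisms ?G" and fixed: "\<forall>w \<in> {0, 1}. f w = w"
      obtain u where "\<And>x. x \<in> ?V \<Longrightarrow> n dvd f x - (u * x + f 0)"
        using affine[OF f] by blast
      from affine_fixing_0_1[OF automorphism_permutes[OF f] this] show "f = id"
        using fixed n by simp
    qed
    then show "\<exists>W. determining_set ?G W \<and> card W = 2"
      by (intro exI[of _ "{0, 1}"]) simp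
  next
    fix k
    assume "\<exists>W. determining_set ?G W \<and> card W = k"
    then obtain W where W: "determining_set ?G W" "card W = k"
      by blast
    then have sub: "W \<subseteq> ?V"
      by (simp add: determining_set_def)
    show "2 \<le> k"
    proof (rule ccontr)
      assume "\<not> 2 \<le> k"
      moreover have "finite W"
        using sub finite_subset by blast
      ultimately obtain a where a: "W \<subseteq> {a}"
        using W(2) card_le_Suc0_iff_eq[of W] by (cases "W = {}") auto
      have "\<forall>w \<in> W. reflection n (2 * a) w = w"
        using a sub by (auto simp: reflection_def)
      then show False
        using W(1) refl[of "2 * a"] unfolding determining_set_def by blast
    qed
  qed
  define col where "col v = (if v \<in> {0, 1, c} then 1 else 0 :: nat)" for v :: int
  have col1: "color_class ?G col 1 = {0, 1, c}"
    using n c by (auto simp: color_class_def col_def)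
  have col: "distinguishing_coloring ?G 2 col"
    unfolding distinguishing_coloring_def
  proof (intro conjI ballI impI)
    show "col ` pverts ?G \<subseteq> {..<2}"
      by (auto simp: col_def)
    fix f
    assume "f \<in> automorphisms ?G" "\<forall>q<2. f ` color_class ?G col q = color_class ?G col q"
    then show "f = id"
      using rigid col1 by (metis one_less_numeral_iff semiring_norm(76))
  qed
  have class_bound: "3 \<le> card (color_class ?G h q)" if h: "distinguishing_coloring ?G 2 h" and q: "q < 2" for h q
  proof (rule ccontr)
    let ?P = "color_class ?G h q"
    assume "\<not> 3 \<le> card ?P"
    moreover have sub: "?P \<subseteq> ?V"
      by (auto simp: color_class_def)
    ultimately obtain s where s: "reflection n s ` ?P = ?P"
      using reflection_preserving_pair[of n ?P] n by force
    have perm: "reflection n s permutes ?V"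
      using refl(1) by (rule automorphism_permutes)
    have "reflection n s ` color_class ?G h r = color_class ?G h r" if "r < 2" for r
    proof (cases "r = q")
      case False
      have "\<forall>v \<in> ?V. h v < 2"
        using h by (auto simp: distinguishing_coloring_def)
      then have "\<forall>v \<in> ?V. h v = q \<or> h v = r"
        using q \<open>r < 2\<close> False by fastforce
      then have "color_class ?G h r = ?V - ?P"
        using False by (auto simp: color_class_def)
      then show ?thesis
        using s permutes_image[OF perm] permutes_inj[OF perm] by (simp only: image_set_diff)
    qed (use s in simp)
    then show False
      using h refl[of s] unfolding distinguishing_coloring_def by blast
  qed
  have "Dist ?G = 2"
    unfolding Dist_def
  proof (rule Least_equality)
    show "\<exists>h. distinguishing_coloring ?G 2 h"
      using col by blast
  next
    fix d
    assume "\<exists>h. distinguishing_coloring ?G d h"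
    then obtain h where h: "distinguishing_coloring ?G d h"
      by blast
    show "2 \<le> d"
    proof (rule ccontr)
      assume "\<not> 2 \<le> d"
      then have const: "h v = 0" "0 < d" if "v \<in> ?V" for v
        using h that by (force simp: distinguishing_coloring_def)+
      have "color_class ?G h r = ?V" if "r < d" for r
        using const that \<open>\<not> 2 \<le> d\<close> by (auto simp: color_class_def)
      moreover have "reflection n 0 ` ?V = ?V"
        using refl(1) by (rule permutes_image[OF automorphism_permutes])
      ultimately show False
        using h refl[of 0] unfolding distinguishing_coloring_def by auto
    qed
  qed
  moreover have "cost ?G = 3"
    unfolding cost_def
  proof (rule Least_equality)
    show "\<exists>h q. distinguishing_coloring ?G 2 h \<and> q < 2 \<and> card (color_class ?G h q) = 3"
      using col col1 c01 by (intro exI[of _ col] exI[of _ 1]) simp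
  qed (use class_bound in blast)
  ultimately show ?thesis
    using \<open>Det ?G = 2\<close> by blast
qed

section \<open>Consequences of twin-freeness\<close>

text \<open>Translation by \<open>i + j\<close>, which has order two here, maps \<open>i\<close> to \<open>-j\<close> and \<open>j\<close> to \<open>-i\<close>. It
  preserves the connection set, so it moves each vertex to a twin.\<close>

lemma not_twin_free_if_half_sum:
  assumes "0 < i" "i < j" "2 * (i + j) = n"
  shows "\<not> twin_free (circulant n i j)"
proof -
  have "is_step n i j (0 - u) \<longleftrightarrow> is_step n i j (i + j - u)" for u
  proof -
    have shift: "i + j - u - i = 0 - u + j" "i + j - u - j = 0 - u + i"
      "i + j - u + i = 0 - u - j + n" "i + j - u + j = 0 - u - i + n"
      using assms by simp_all
    show ?thesis
      unfolding is_step_def shift by auto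
  qed
  then have "open_neighborhood (circulant n i j) 0 = open_neighborhood (circulant n i j) (i + j)"
    using assms by (auto simp: open_neighborhood_def parcs_circulant_iff)
  then have "twins (circulant n i j) 0 (i + j)"
    using assms by (simp add: twins_def)
  then show ?thesis
    by (auto simp: twin_free_def)
qed

text \<open>These are the complete graphs on four and five vertices.\<close>

lemma not_twin_free_complete:
  assumes "(n, j) = (4, 2) \<or> (n, j) = (5, 2)"
  shows "\<not> twin_free (circulant n 1 j)"
proof -
  have "closed_neighborhood (circulant n 1 j) v = {0..n - 1}" if "v \<in> {0..n - 1}" for v
  proof -
    have "{0..3 :: int} = {0, 1, 2, 3}" "{0..4 :: int} = {0, 1, 2, 3, 4}"
      by auto
    then have "\<forall>v \<in> {0..n - 1}. \<forall>u \<in> {0..n - 1}. u = v \<or> is_step n 1 j (v - u)"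
      using assms by (auto simp: is_step_def)
    then show ?thesis
      using that by (auto simp: closed_neighborhood_def open_neighborhood_def parcs_circulant_iff)
  qed
  then have "twins (circulant n 1 j) 0 1"
    using assms by (auto simp: twins_def)
  then show ?thesis
    by (auto simp: twin_free_def)
qed

text \<open>This is the complete bipartite graph with parts of size three.\<close>

lemma not_twin_free_K33: "\<not> twin_free (circulant 6 1 3)"
proof -
  have "{0..5 :: int} = {0, 1, 2, 3, 4, 5}"
    by auto
  then have "\<forall>u \<in> {0..5}. is_step 6 1 3 (0 - u) \<longleftrightarrow> is_step 6 1 3 (2 - u)"
    by (auto simp: is_step_def)
  then have "open_neighborhood (circulant 6 1 3) 0 = open_neighborhood (circulant 6 1 3) 2"
    by (auto simp: open_neighborhood_def parcs_circulant_iff)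
  then have "twins (circulant 6 1 3) 0 2"
    by (auto simp: twins_def)
  then show ?thesis
    by (auto simp: twin_free_def)
qed

lemma twin_free_ge_7:
  assumes "1 < j" "2 * j \<le> n" "twin_free (circulant n 1 j)"
  shows "7 \<le> n"
proof (rule ccontr)
  assume "\<not> 7 \<le> n"
  then have "n \<in> {4, 5, 6}" "j \<in> {2, 3}" "2 * j \<le> n"
    using assms by auto
  then show False
    using assms(3) not_twin_free_if_half_sum[of 1 j n] not_twin_free_complete[of n j] not_twin_free_K33 by auto
qed


section \<open>All automorphisms are affine\<close>

lemma dvd_between:
  fixes n m :: int
  assumes "n dvd m" "0 < m" "m < 2 * n"
  shows "m = n"
proof -
  obtain k where k: "m = n * k"
    using assms(1) by blast
  have "0 < n"
    using assms by simp
  have "0 < n * k" "n * k < n * 2"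
    using assms(2,3) unfolding k by (simp_all only: mult.commute[of n 2])
  then have "0 < k" "k < 2"
    using zero_less_mult_pos \<open>0 < n\<close> mult_less_cancel_left_pos[OF \<open>0 < n\<close>] by blast+
  then show ?thesis
    using k by simp
qed

lemma not_dvd_between:
  fixes n m :: int
  assumes "0 < m" "m < n"
  shows "\<not> n dvd m"
  using assms zdvd_not_zless by blast

text \<open>A common divisor of \<open>i\<close> and \<open>n\<close> divides \<open>j\<close> too. So the coincidence \<open>3 * i = \<plusminus> j\<close> makes \<open>i\<close>
  a unit.\<close>

lemma coprime_if_generated:
  fixes n i j :: int
  assumes gen: "n dvd p * i + q * j - 1" and ij: "n dvd 3 * i - j \<or> n dvd 3 * i + j"
  shows "coprime i n"
proof (rule coprimeI)
  fix d
  assume d: "d dvd i" "d dvd n"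
  have "d dvd 3 * i - j \<or> d dvd 3 * i + j"
    using ij dvd_trans[OF d(2)] by blast
  moreover have "d dvd 3 * i"
    using d(1) by simp
  ultimately have "d dvd j"
    by (auto simp: dvd_add_right_iff dvd_diff_right_iff)
  then have "d dvd p * i + q * j"
    using d(1) by simp
  moreover have "d dvd p * i + q * j - 1"
    using dvd_trans[OF d(2) gen] .
  ultimately show "is_unit d"
    using dvd_diff[of d "p * i + q * j" "p * i + q * j - 1"] by simp
qed

text \<open>The coincidences \<open>2 * i = \<plusminus> 2 * j\<close> lead to twins, and those between a step and three times
  the other step require a unit. What remains is that one of the steps may have order 4 or 2,
  and this step has to play the role of \<open>b\<close>. If \<open>4 * i = n\<close>, then the order of \<open>j\<close> is neither:
  \<open>4 * j = n\<close> would give \<open>i = j\<close>, and \<open>2 * j = n\<close> would give \<open>j = 2 * i\<close>, hence \<open>i = 1\<close> and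
  \<open>n = 4\<close>.\<close>

lemma generic_steps_circulant:
  fixes n i j :: int
  assumes ij: "0 < i" "i < j" "2 * j \<le> n" and gen: "n dvd p * i + q * j - 1"
    and half: "2 * (i + j) \<noteq> n"
    and one: "i = 1 \<Longrightarrow> 7 \<le> n \<and> j \<noteq> 3 \<and> \<not> n dvd 3 * j - 1 \<and> \<not> n dvd 3 * j + 1"
    and nonunit: "i \<noteq> 1 \<Longrightarrow> \<not> coprime i n \<and> \<not> coprime j n"
  shows "generic_steps n i j \<or> generic_steps n j i"
proof -
  have two: "\<not> n dvd 2 * i - 2 * j" "\<not> n dvd 2 * i + 2 * j"
    using not_dvd_between[of "2 * j - 2 * i" n] dvd_between[of n "2 * i + 2 * j"] ij half
    by (auto simp: dvd_diff_commute)
  have gen': "n dvd q * j + p * i - 1"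
    using gen by (simp add: add.commute)
  have three: "\<not> n dvd 3 * i - j \<and> \<not> n dvd 3 * i + j \<and> \<not> n dvd 3 * j - i \<and> \<not> n dvd 3 * j + i"
  proof (cases "i = 1")
    case True
    have "n dvd 3 - j \<longleftrightarrow> n dvd j - 3"
      by (rule dvd_diff_commute)
    then show ?thesis
      using one[OF True] True ij not_dvd_between[of "3 - j" n] not_dvd_between[of "j - 3" n]
        not_dvd_between[of "3 + j" n]
      by (cases "j < 3") (auto simp: True)
  next
    case False
    then show ?thesis
      using nonunit coprime_if_generated[OF gen] coprime_if_generated[OF gen'] by blast
  qed
  show ?thesis
  proof (cases "n dvd 4 * i")
    case False
    then have "generic_steps n i j"
      using two three by unfold_locales auto
    then show ?thesis ..
  next
    case True
    then have n: "n = 4 * i"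
      using dvd_between[of n "4 * i"] ij by simp
    have "2 * j \<noteq> n"
    proof
      assume "2 * j = n"
      then have "j = 2 * i"
        using n by simp
      have "i dvd p * i + q * j - 1"
        using gen n by (auto intro: dvd_trans[of i n])
      moreover have "i dvd p * i + q * j"
        using \<open>j = 2 * i\<close> by simp
      ultimately have "i dvd 1"
        using dvd_diff[of i "p * i + q * j" "p * i + q * j - 1"] by simp
      then have "i = 1"
        using ij by simp
      then show False
        using one n by simp
    qed
    then have "\<not> n dvd 4 * j"
      using dvd_between[of n "4 * j"] ij n by auto
    moreover have "\<not> n dvd 2 * j - 2 * i" "\<not> n dvd 2 * j + 2 * i"
      using two by (simp_all add: dvd_diff_commute add.commute)
    ultimately have "generic_steps n j i"
      using three by unfold_locales auto
    then show ?thesis ..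
  qed
qed

lemma automorphism_affine_generic:
  assumes "0 < n" and gen: "n dvd p * i + q * j - 1"
    and steps: "generic_steps n i j \<or> generic_steps n j i"
    and f: "f \<in> automorphisms (circulant n i j)"
  shows "\<exists>u. \<forall>x. n dvd f (x mod n) - (u * x + f 0)"
proof -
  let ?F = "\<lambda>x. f (x mod n)"
  interpret circulant_symmetry n i j ?F
    using assms(1) f by (rule circulant_symmetry_automorphism)
  from steps show ?thesis
  proof
    assume "generic_steps n i j"
    then interpret generic_steps n i j .
    interpret generic_symmetry n i j ?F ..
    show ?thesis
      using generic_symmetry_affine[OF gen] by simp
  next
    assume "generic_steps n j i"
    then interpret generic_steps n j i .
    interpret generic_symmetry n j i ?F
      using inj surj step_iff by unfold_locales (simp_all add: is_step_swap[of n j i])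
    show ?thesis
      using generic_symmetry_affine[of q p] gen by (simp add: add.commute)
  qed
qed

lemma is_step_triple:
  assumes "n dvd 3 * j - 1 \<or> n dvd 3 * j + 1"
  shows "is_step n 1 j = is_step n j (3 * j)"
proof
  fix d
  have "n dvd x \<longleftrightarrow> n dvd y" if "n dvd x - y" for x y :: int
    using that by (metis dvd_diff_right_iff dvd_diff_left_iff)
  from this[of "d - 1" "d - 3 * j"] this[of "d + 1" "d + 3 * j"]
    this[of "d - 1" "d + 3 * j"] this[of "d + 1" "d - 3 * j"] assms
  show "is_step n 1 j d = is_step n j (3 * j) d"
    using dvd_minus_iff[of n "3 * j - 1"] dvd_minus_iff[of n "3 * j + 1"]
    by (auto simp: is_step_def algebra_simps)
qed

text \<open>If \<open>3 * j = \<plusminus> 1\<close>, then 1 is, up to sign, three times the generator \<open>j\<close>. The exceptions 8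
  and 10 give, with \<open>j = 3\<close>, the complete bipartite graph with parts of size four and the one
  with parts of size five minus a perfect matching; these have automorphisms that are not
  affine.\<close>

lemma automorphism_affine_triple:
  assumes n: "7 \<le> n" "n \<noteq> 8" "n \<noteq> 10" and j: "j = 3 \<or> n dvd 3 * j - 1 \<or> n dvd 3 * j + 1"
    and f: "f \<in> automorphisms (circulant n 1 j)"
  shows "\<exists>u. (n dvd u - 1 \<or> n dvd u + 1) \<and> (\<forall>x. n dvd f (x mod n) - (u * x + f 0))"
proof -
  let ?F = "\<lambda>x. f (x mod n)"
  interpret circulant_symmetry n 1 j ?F
    using f n by (intro circulant_symmetry_automorphism) auto
  obtain a p where a: "is_step n 1 j = is_step n a (3 * a)" and p: "n dvd p * a - 1"
  proof (cases "j = 3")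
    case True
    then show ?thesis
      using that[of 1 1] by simp
  next
    case False
    with j have "n dvd 3 * j - 1 \<or> n dvd - 3 * j - 1"
      using dvd_minus_iff[of n "3 * j + 1"] by simp
    then show ?thesis
      using that[of j] is_step_triple[of n j] False j by blast
  qed
  have ka: "\<not> n dvd k * a" if "\<not> n dvd k" for k
  proof
    assume "n dvd k * a"
    from dvd_diff[OF dvd_mult[OF this, of p] dvd_mult[OF p, of k]] have "n dvd k"
      by (simp add: algebra_simps)
    with that show False ..
  qed
  have "\<not> n dvd 6" "\<not> n dvd 8" "\<not> n dvd 10"
    using n dvd_between[of n 6] dvd_between[of n 8] dvd_between[of n 10] by auto
  then interpret triple_steps n a
    using ka by unfold_locales auto
  interpret triple_symmetry n a ?F
    using inj surj step_iff by unfold_locales (simp_all add: a)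
  show ?thesis
    using triple_symmetry_affine[OF p] by simp
qed

section \<open>The choice of the third vertex\<close>

text \<open>The slope of an automorphism is a step, because it is the difference of the images of 1 and
  0. The third vertex \<open>c = 3\<close> works: the slopes to avoid are \<open>\<plusminus> 3\<close> and \<open>\<plusminus> 2\<close>. If \<open>j\<close> is
  neither 2 nor 3, none of these is a step. For \<open>j = 2\<close> the slope \<open>\<plusminus> 2\<close> would map the step 2
  to \<open>\<plusminus> 4\<close>, which is not a step. For \<open>j = 3\<close> the only slopes are \<open>\<plusminus> 1\<close>.\<close>

lemma invariants_unit_step:
  fixes n j :: int
  assumes j: "1 < j" "2 * j \<le> n" and tf: "twin_free (circulant n 1 j)" and ne: "(n, j) \<noteq> (10, 3)"
  shows "Det (circulant n 1 j) = 2 \<and> Dist (circulant n 1 j) = 2 \<and> cost (circulant n 1 j) = 3"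
proof (rule invariants_if_affine[where c = 3])
  have n: "7 \<le> n"
    using j tf by (rule twin_free_ge_7)
  then show "3 \<le> n" "3 \<in> {0..n - 1}" "\<not> n dvd 2 * 3 - 1"
    using not_dvd_between[of 5 n] by auto
  have half: "2 * (1 + j) \<noteq> n"
    using not_twin_free_if_half_sum[of 1 j n] j tf by auto
  have nd: "\<not> n dvd 1" "\<not> n dvd 2" "\<not> n dvd 3" "\<not> n dvd 4" "\<not> n dvd 5" "\<not> n dvd 6"
    using n by (simp_all add: not_dvd_between)
  fix f
  assume f: "f \<in> automorphisms (circulant n 1 j)"
  have "\<exists>u. (\<forall>x. n dvd f (x mod n) - (u * x + f 0)) \<and>
    \<not> n dvd u - 3 \<and> \<not> n dvd u + 3 \<and> \<not> n dvd u + 2 \<and> \<not> n dvd u - 2"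
  proof (cases "j = 3 \<or> n dvd 3 * j - 1 \<or> n dvd 3 * j + 1")
    case True
    have "n \<noteq> 8 \<and> n \<noteq> 10"
    proof (rule ccontr)
      assume *: "\<not> ?thesis"
      then have "j \<in> {2, 3, 4, 5}"
        using j by auto
      then show False
        using * True half ne j by auto
    qed
    then obtain u where "n dvd u - 1 \<or> n dvd u + 1" "\<forall>x. n dvd f (x mod n) - (u * x + f 0)"
      using automorphism_affine_triple[OF n _ _ True f] by blast
    moreover have "\<not> n dvd u + k" if "\<not> n dvd k - 1" "\<not> n dvd k + 1" for k
      using calculation(1) that dvd_diff[of n "u + k" "u - 1"] dvd_diff[of n "u + k" "u + 1"] by auto
    from this[of 2] this[of "-2"] this[of 3] this[of "-3"]
    have "\<not> n dvd u - 3 \<and> \<not> n dvd u + 3 \<and> \<not> n dvd u + 2 \<and> \<not> n dvd u - 2"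
      using nd by simp
    ultimately show ?thesis
      by blast
  next
    case False
    have gen: "n dvd 1 * 1 + 0 * j - 1"
      by simp
    have "generic_steps n 1 j \<or> generic_steps n j 1"
      using j n False half by (intro generic_steps_circulant[OF _ _ _ gen]) auto
    then obtain u where u: "\<forall>x. n dvd f (x mod n) - (u * x + f 0)"
      using automorphism_affine_generic[OF _ gen _ f] n by auto
    interpret circulant_symmetry n 1 j "\<lambda>x. f (x mod n)"
      using f n by (intro circulant_symmetry_automorphism) auto
    \<comment> \<open>Multiplication by the slope maps steps to steps.\<close>
    have img: "is_step n 1 j (u * x)" if "is_step n 1 j x" for x
    proof -
      have "is_step n 1 j (f (x mod n) - f (0 mod n))"
        using that by (simp only: step_iff diff_0_right)
      moreover have "n dvd (f (x mod n) - f (0 mod n)) - u * x"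
        using u[rule_format, of x] by (simp add: algebra_simps)
      ultimately show ?thesis
        using is_step_cong by blast
    qed
    have u1: "is_step n 1 j u"
      using img[of 1] by (simp add: is_step_def)
    have uj: "is_step n 1 j (u * j)"
      using img[of j] by (simp add: is_step_def)
    have jn: "\<not> n dvd 3 - j" "\<not> n dvd 3 + j" "\<not> n dvd 2 + j" "n dvd 2 - j \<Longrightarrow> j = 2"
      using j n False not_dvd_between[of "3 - j" n] not_dvd_between[of "j - 3" n]
        not_dvd_between[of "3 + j" n] not_dvd_between[of "2 + j" n] not_dvd_between[of "j - 2" n]
        dvd_diff_commute[of n 3 j] dvd_diff_commute[of n 2 j]
      by (cases "j < 3"; auto)+
    have "\<not> is_step n 1 j 3"
      using nd jn by (simp add: is_step_def)
    moreover have two: "j = 2" if "is_step n 1 j 2"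
      using nd jn that by (simp add: is_step_def)
    moreover have "\<not> is_step n 1 2 4"
      using nd by (simp add: is_step_def)
    moreover have "is_step n 1 j e \<and> is_step n 1 j (e * j)" if "n dvd u - e" for e
    proof -
      have "n dvd u * j - e * j"
        using dvd_mult2[OF that, of j] by (simp add: algebra_simps)
      then show ?thesis
        using is_step_cong[OF that] is_step_cong[of n "u * j"] u1 uj by blast
    qed
    from this[of 3] this[of "-3"] this[of 2] this[of "-2"]
    have "(n dvd u - 3 \<longrightarrow> is_step n 1 j 3) \<and> (n dvd u + 3 \<longrightarrow> is_step n 1 j 3)
      \<and> (n dvd u - 2 \<longrightarrow> is_step n 1 j 2 \<and> is_step n 1 j (2 * j))
      \<and> (n dvd u + 2 \<longrightarrow> is_step n 1 j 2 \<and> is_step n 1 j (2 * j))"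
      using is_step_minus[of n 1 j 3] is_step_minus[of n 1 j 2] is_step_minus[of n 1 j "2 * j"] by simp
    ultimately have "\<not> n dvd u - 3 \<and> \<not> n dvd u + 3 \<and> \<not> n dvd u + 2 \<and> \<not> n dvd u - 2"
      by auto
    then show ?thesis
      using u by blast
  qed
  then obtain u where u: "\<forall>x. n dvd f (x mod n) - (u * x + f 0)"
    "\<not> n dvd u - 3" "\<not> n dvd u + 3" "\<not> n dvd u + 2" "\<not> n dvd u - 2"
    by blast
  have "n dvd f x - (u * x + f 0)" if "x \<in> {0..n - 1}" for x
    using u(1)[rule_format, of x] that by simp
  with u(2-) show "\<exists>u. (\<forall>x \<in> {0..n - 1}. n dvd f x - (u * x + f 0)) \<and>
        \<not> n dvd u - 3 \<and> \<not> n dvd u + 3 \<and> \<not> n dvd u - (1 - 3) \<and> \<not> n dvd u + (1 - 3)"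
    by (intro exI[of _ u]) simp
qed

text \<open>Write 1 as \<open>p * i + q * j\<close> and take \<open>c = p * i\<close>, so that \<open>1 - c = q * j\<close>. Then \<open>c\<close> and
  \<open>1 - c\<close> are not units, whereas every slope is a unit, since affine bijections have unit
  slope. Moreover \<open>2 * c\<close> is not a unit, so it differs from 1.\<close>

lemma invariants_nonunit_steps:
  fixes n i j :: int
  assumes ij: "0 < i" "i < j" "2 * j \<le> n" and i1: "i \<noteq> 1"
    and nonunit: "\<not> coprime i n" "\<not> coprime j n"
    and gen: "n dvd p * i + q * j - 1" and half: "2 * (i + j) \<noteq> n"
  shows "Det (circulant n i j) = 2 \<and> Dist (circulant n i j) = 2 \<and> cost (circulant n i j) = 3"
proof -
  have n: "0 < n" "3 \<le> n"
    using ij by auto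
  define c where "c = (p * i) mod n"
  have c: "n dvd c - p * i"
    by (simp add: c_def mod_eq_dvd_iff[symmetric])
  obtain d where d: "d dvd i" "d dvd n" "\<not> is_unit d"
    using nonunit(1) not_coprimeE by blast
  obtain e where e: "e dvd j" "e dvd n" "\<not> is_unit e"
    using nonunit(2) not_coprimeE by blast
  have dc: "d dvd c"
    using dvd_trans[OF d(2) c] dvd_mult[OF d(1), of p] by (simp add: dvd_diff_left_iff)
  have "n dvd q * j - (1 - c)"
    using dvd_add[OF gen c] by (simp add: algebra_simps)
  then have ec: "e dvd 1 - c"
    using dvd_diff[OF dvd_mult[OF e(1), of q] dvd_trans[OF e(2)]] by fastforce
  have steps: "generic_steps n i j \<or> generic_steps n j i"
    using ij gen half i1 nonunit by (intro generic_steps_circulant) auto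
  show ?thesis
  proof (rule invariants_if_affine[where c = c])
    show "3 \<le> n" "c \<in> {0..n - 1}"
      using n by (simp_all add: c_def pos_mod_bound zle_diff1_eq)
    show "\<not> n dvd 2 * c - 1"
    proof
      assume "n dvd 2 * c - 1"
      then have "d dvd 2 * c - 1"
        using d(2) dvd_trans by blast
      then show False
        using d(3) dc dvd_diff[of d "2 * c" "2 * c - 1"] by simp
    qed
    fix f
    assume f: "f \<in> automorphisms (circulant n i j)"
    then obtain u where u: "\<forall>x. n dvd f (x mod n) - (u * x + f 0)"
      using automorphism_affine_generic[OF n(1) gen steps] by blast
    interpret circulant_symmetry n i j "\<lambda>x. f (x mod n)"
      using f n by (intro circulant_symmetry_automorphism)
    obtain y where y: "n dvd f (y mod n) - (1 + f 0)"
      using surj by blast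
    have unit: "is_unit k" if "k dvd n" "k dvd u" for k
    proof -
      have "n dvd u * y - 1"
        using dvd_diff[OF y u[rule_format, of y]] by (simp add: algebra_simps)
      then have "k dvd u * y - 1"
        using that(1) dvd_trans by blast
      then show ?thesis
        using dvd_diff[of k "u * y" "u * y - 1"] that(2) by simp
    qed
    have avoid: "\<not> n dvd u - r" "\<not> n dvd u + r"
      if k: "k dvd n" "\<not> is_unit k" "k dvd r" for k r
    proof -
      have "\<not> k dvd u"
        using unit k by blast
      then have "\<not> k dvd u - r" "\<not> k dvd u + r"
        using dvd_add[OF _ k(3), of "u - r"] dvd_diff[OF _ k(3), of "u + r"] by auto
      then show "\<not> n dvd u - r" "\<not> n dvd u + r"
        using dvd_trans[OF k(1)] by blast+
    qed
    note avoid[OF d(2,3) dc] avoid[OF e(2,3) ec]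
    moreover have "n dvd f x - (u * x + f 0)" if "x \<in> {0..n - 1}" for x
      using u[rule_format, of x] that by simp
    ultimately show "\<exists>u. (\<forall>x \<in> {0..n - 1}. n dvd f x - (u * x + f 0)) \<and>
        \<not> n dvd u - c \<and> \<not> n dvd u + c \<and> \<not> n dvd u - (1 - c) \<and> \<not> n dvd u + (1 - c)"
      by (intro exI[of _ u]) simp
  qed
qed

text \<open>A third vertex that breaks all symmetry is found in two different ways, according to
  whether 1 is a step or both steps are zero divisors; in the second case it comes from the
  Bezout coefficients that connectedness supplies.\<close>

theorem theorem16:
  fixes n i j :: int
  assumes "0 < i" and "i < j" and "2 * j \<le> n"
    and "i = 1 \<or> (i \<notin> Units (residue_ring n) \<and> j \<notin> Units (residue_ring n))"
    and "connected (circulant n i j)"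
    and "twin_free (circulant n i j)"
    and "(n, i, j) \<noteq> (10, 1, 3)"
  shows "Det (circulant n i j) = 2 \<and> Dist (circulant n i j) = 2 \<and> cost (circulant n i j) = 3"
proof (cases "i = 1")
  case True
  then show ?thesis
    using invariants_unit_step[of j n] assms by simp
next
  case False
  interpret residues n "residue_ring n"
    using assms(1-3) by unfold_locales auto
  have "\<not> coprime i n" "\<not> coprime j n"
    using False assms(1-4) by (auto simp: res_units_eq)
  moreover obtain p q where "n dvd p * i + q * j - 1"
    using connected_circulant_generates[of n i j] assms by auto
  moreover have "2 * (i + j) \<noteq> n"
    using not_twin_free_if_half_sum assms by blast
  ultimately show ?thesis
    using invariants_nonunit_steps assms(1-3) False by blast
qed

end
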